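(* Let $f$ and $g$ be harmonic curves on a domain $\Omega\subset\mathbb{R}^n$ with $f,g\in C^0(\overline{\Omega})$, and denote by $\mathsf{z}(f)$ and $\mathsf{z}(g)$ their horizontal parts. Suppose that $\mathsf{z}(f)\neq0$ and $\mathsf{z}(g)\ne0$ in $\Omega$, and that in $\Omega$ $$\Delta|\mathsf{z}(f)|+\frac{\big|\nabla|\mathsf{z}(f)|\big|^2}{|\mathsf{z}(f)|}\ge0,\qquad \Delta|\mathsf{z}(g)|+\frac{\big|\nabla|\mathsf{z}(g)|\big|^2}{|\mathsf{z}(g)|}\le0 .$$ If $|\mathsf{z}(f)|\le|\mathsf{z}(g)|$ on $\partial\Omega$, then $|\mathsf{z}(f)|\le|\mathsf{z}(g)|$ in $\Omega$.
   Context: The first Heisenberg group $\mathbb{H}^1$ is $\mathbb{R}^3$ with coordinates $(\mathsf{x},\mathsf{y},\mathsf{t})$ and contact form $\theta=d\mathsf{t}+2(\mathsf{x}\,d\mathsf{y}-\mathsf{y}\,d\mathsf{x})$. Let $\Omega\subset\mathbb{R}^n$ be a domain. A harmonic curve (also called $C^2$-harmonic mapping) is a $C^2$ map $f=(\mathsf{x},\mathsf{y},\mathsf{t}):\Omega\to\mathbb{H}^1$, also written $f=(\mathsf{z},\mathsf{t})$ with horizontal part $\mathsf{z}=\mathsf{z}(f)=\mathsf{x}+i\mathsf{y}$, such that: (1) (isotropicity) $\frac{\partial\mathsf{x}}{\partial x_\alpha}\frac{\partial\mathsf{y}}{\partial x_\beta}-\frac{\partial\mathsf{x}}{\partial x_\beta}\frac{\partial\mathsf{y}}{\partial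 x_\alpha}=0$ for all $\alpha<\beta$, and the contact condition $f^*\theta=0$ holds, i.e. $\nabla\mathsf{t}=2(\mathsf{y}\nabla\mathsf{x}-\mathsf{x}\nabla\mathsf{y})$; (2) (criticality) $\mathsf{z}$ is a critical point of $E^2(f)=\int_\Omega|\nabla\mathsf{z}|^2dx$, where $|\nabla\mathsf{z}|^2=|\nabla\mathsf{x}|^2+|\nabla\mathsf{y}|^2$, with respect to domain variations $\mathsf{z}_s(x)=\mathsf{z}(x+s\xi(x))$, $\xi\in C_0^\infty(\Omega,\mathbb{R}^n)$; that is, for all $\phi\in C_0^\infty(\Omega)$ and $\gamma=1,\dots,n$, $$\int_\Omega\Big(|\nabla\mathsf{z}|^2\frac{\partial\phi}{\partial x_\gamma}-2\sum_{\beta=1}^n\Big(\frac{\partial\mathsf{x}}{\partial x_\beta}\frac{\partial\mathsf{x}}{\partial x_\gamma}+\frac{\partial\mathsf{y}}{\partial x_\beta}\frac{\partial\mathsf{y}}{\partial x_\gamma}\Big)\frac{\partial\phi}{\partial x_\beta}\Big)dx=0.$$ Throughout, $\mathsf{x}=H\circ\mathsf{y}$ for a $C^2$ function $H:I\to\mathbb{R}$ (depending on the map) on an interval $I\supset\mathsf{y}(\Omega)$. For such maps, criticality is equivalent to $$\Delta\mathsf{y}=-\frac{(H''\circ\mathsf{y})(H'\circ\mathsf{y})}{1+(H'\circ\mathsf{y})^2}|\nabla\mathsf{y}|^2\quad\text{in }\Omega.$$ Here $|\mathsf{z}|=(\mathsf{x}^2+\mathsf{y}^2)^{1/2}$, and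 $f\in C^0(\overline\Omega)$ means that $f$ extends continuously to $\overline\Omega$.
   Formalization: The domain Ω is additionally assumed bounded; without this the claim fails, e.g. for Ω=(1,∞), z(f)(s)=is, z(g)=i, where |z(f)|=|z(g)| at the boundary point but |z(f)|>|z(g)| in Ω. *)

theory Defs
  imports "HOL-Analysis.Analysis"
begin

definition partial :: "'n::finite \<Rightarrow> (real^'n \<Rightarrow> real) \<Rightarrow> real^'n \<Rightarrow> real" where
  "partial i u p = deriv (\<lambda>s. u (p + s *\<^sub>R axis i 1)) 0"

definition grad :: "(real^'n::finite \<Rightarrow> real) \<Rightarrow> real^'n \<Rightarrow> real^'n" where
  "grad u p = (\<chi> i. partial i u p)"

definition laplacian :: "(real^'n::finite \<Rightarrow> real) \<Rightarrow> real^'n \<Rightarrow> real" where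
  "laplacian u p = (\<Sum>i\<in>UNIV. partial i (partial i u) p)"

text \<open>The class \<open>C\<^sup>k(\<Omega>)\<close>, intended for open \<open>\<Omega>\<close>. Requiring differentiability in the sense of
  Frechet at each stage is no restriction there: it follows from continuity of the partial
  derivatives.\<close>

primrec Ck_on :: "nat \<Rightarrow> (real^'n::finite) set \<Rightarrow> (real^'n \<Rightarrow> real) \<Rightarrow> bool" where
  "Ck_on 0 \<Omega> u \<longleftrightarrow> continuous_on \<Omega> u"
| "Ck_on (Suc k) \<Omega> u \<longleftrightarrow> u differentiable_on \<Omega> \<and> (\<forall>i. Ck_on k \<Omega> (partial i u))"

text \<open>The space \<open>C\<^sub>0\<^sup>\<infinity>(\<Omega>)\<close>; its elements are extended by zero to the whole space.\<close>

definition test_function :: "(real^'n::finite) set \<Rightarrow> (real^'n \<Rightarrow> real) \<Rightarrow> bool" where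
  "test_function \<Omega> \<phi> \<longleftrightarrow> (\<forall>k. Ck_on k UNIV \<phi>) \<and>
     compact (closure {p. \<phi> p \<noteq> 0}) \<and> closure {p. \<phi> p \<noteq> 0} \<subseteq> \<Omega>"

text \<open>Maps into the Heisenberg group are maps into \<open>real^3\<close>, with coordinates \<open>(x, y, t)\<close>.\<close>

definition xpart :: "('a \<Rightarrow> real^3) \<Rightarrow> 'a \<Rightarrow> real" where "xpart f p = f p $ 1"
definition ypart :: "('a \<Rightarrow> real^3) \<Rightarrow> 'a \<Rightarrow> real" where "ypart f p = f p $ 2"
definition tpart :: "('a \<Rightarrow> real^3) \<Rightarrow> 'a \<Rightarrow> real" where "tpart f p = f p $ 3"

definition zpart :: "('a \<Rightarrow> real^3) \<Rightarrow> 'a \<Rightarrow> complex" where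
  "zpart f p = Complex (xpart f p) (ypart f p)"

text \<open>The expression below is antisymmetric in \<open>\<alpha>, \<beta>\<close>, so asking it to vanish for all pairs of
  indices is the same as asking it for \<open>\<alpha> < \<beta>\<close>; no order on the index type is needed.\<close>

definition isotropic_on :: "(real^'n::finite) set \<Rightarrow> (real^'n \<Rightarrow> real^3) \<Rightarrow> bool" where
  "isotropic_on \<Omega> f \<longleftrightarrow> (\<forall>p\<in>\<Omega>. \<forall>\<alpha> \<beta>.
     partial \<alpha> (xpart f) p * partial \<beta> (ypart f) p
       - partial \<beta> (xpart f) p * partial \<alpha> (ypart f) p = 0)"

text \<open>The pullback of the contact form \<open>dt + 2 (x dy - y dx)\<close> under \<open>f\<close> vanishes.\<close>

definition contact_on :: "(real^'n::finite) set \<Rightarrow> (real^'n \<Rightarrow> real^3) \<Rightarrow> bool" where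
  "contact_on \<Omega> f \<longleftrightarrow> (\<forall>p\<in>\<Omega>.
     grad (tpart f) p =
       2 *\<^sub>R (ypart f p *\<^sub>R grad (xpart f) p - xpart f p *\<^sub>R grad (ypart f) p))"

definition energy_density :: "(real^'n::finite \<Rightarrow> real^3) \<Rightarrow> real^'n \<Rightarrow> real" where
  "energy_density f p = (norm (grad (xpart f) p))\<^sup>2 + (norm (grad (ypart f) p))\<^sup>2"

text \<open>The first variation of the Dirichlet energy \<open>\<integral>\<^sub>\<Omega> |\<nabla>z|\<^sup>2\<close> vanishes along all domain variations
  \<open>z(p + s \<xi>(p))\<close> with \<open>\<xi> = \<phi> e\<^sub>\<gamma>\<close>, and hence, by linearity, for all \<open>\<xi>\<close>.\<close>

definition critical_on :: "(real^'n::finite) set \<Rightarrow> (real^'n \<Rightarrow> real^3) \<Rightarrow> bool" where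
  "critical_on \<Omega> f \<longleftrightarrow> (\<forall>\<phi> \<gamma>. test_function \<Omega> \<phi> \<longrightarrow>
     (LINT p:\<Omega>|lborel. energy_density f p * partial \<gamma> \<phi> p
        - 2 * (\<Sum>\<beta>\<in>UNIV. (partial \<beta> (xpart f) p * partial \<gamma> (xpart f) p
                        + partial \<beta> (ypart f) p * partial \<gamma> (ypart f) p) * partial \<beta> \<phi> p)) = 0)"

definition harmonic_curve :: "(real^'n::finite) set \<Rightarrow> (real^'n \<Rightarrow> real^3) \<Rightarrow> bool" where
  "harmonic_curve \<Omega> f \<longleftrightarrow>
     Ck_on 2 \<Omega> (xpart f) \<and> Ck_on 2 \<Omega> (ypart f) \<and> Ck_on 2 \<Omega> (tpart f) \<and>
     isotropic_on \<Omega> f \<and> contact_on \<Omega> f \<and> critical_on \<Omega> f"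

text \<open>\<open>H\<close> is \<open>C\<^sup>2\<close> on the interval \<open>I\<close>, with one-sided derivatives at endpoints belonging to \<open>I\<close>.\<close>

definition C2_on_interval :: "real set \<Rightarrow> (real \<Rightarrow> real) \<Rightarrow> bool" where
  "C2_on_interval I H \<longleftrightarrow> is_interval I \<and> interior I \<noteq> {} \<and>
     (\<exists>H' H''. (\<forall>s\<in>I. (H has_real_derivative H' s) (at s within I)) \<and>
               (\<forall>s\<in>I. (H' has_real_derivative H'' s) (at s within I)) \<and>
               continuous_on I H'')"

definition x_function_of_y_on :: "(real^'n::finite) set \<Rightarrow> (real^'n \<Rightarrow> real^3) \<Rightarrow> bool" where
  "x_function_of_y_on \<Omega> f \<longleftrightarrow> (\<exists>I H. C2_on_interval I H \<and> ypart f ` \<Omega> \<subseteq> I \<and>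
     (\<forall>p\<in>\<Omega>. xpart f p = H (ypart f p)))"

end

theory Submission
  imports Defs
begin

text \<open>On \<open>\<Omega>\<close> one has \<open>\<Delta> |z|\<^sup>2 = 2 |z| (\<Delta> |z| + |\<nabla> |z||\<^sup>2 / |z|)\<close>, so the two differential inequalities
  say that \<open>|z(f)|\<^sup>2\<close> is subharmonic and \<open>|z(g)|\<^sup>2\<close> is superharmonic. The claim is the weak maximum
  principle for their difference.\<close>

definition has_partial :: "'n::finite \<Rightarrow> (real^'n \<Rightarrow> real) \<Rightarrow> real^'n \<Rightarrow> real \<Rightarrow> bool" where
  "has_partial i u p D \<longleftrightarrow> ((\<lambda>s. u (p + s *\<^sub>R axis i 1)) has_real_derivative D) (at 0)"

definition twice_partial_on :: "(real^'n::finite) set \<Rightarrow> (real^'n \<Rightarrow> real) \<Rightarrow> bool" where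
  "twice_partial_on \<Omega> u \<longleftrightarrow> (\<forall>i. \<forall>p\<in>\<Omega>. has_partial i u p (partial i u p) \<and>
     has_partial i (partial i u) p (partial i (partial i u) p))"

lemma has_partial_imp_partial: "has_partial i u p D \<Longrightarrow> partial i u p = D"
  unfolding has_partial_def partial_def by (rule DERIV_imp_deriv)

lemma eventually_line_in_open:
  fixes p :: "real^'n::finite"
  assumes "open \<Omega>" and "p \<in> \<Omega>"
  shows "\<forall>\<^sub>F s in nhds 0. p + s *\<^sub>R axis i 1 \<in> \<Omega>"
proof -
  have "((\<lambda>s. p + s *\<^sub>R axis i 1) \<longlongrightarrow> p + 0 *\<^sub>R axis i 1) (nhds (0::real))"
    by (intro tendsto_intros filterlim_ident)
  then show ?thesis
    using assms topological_tendstoD by fastforce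
qed

lemma has_partial_cong:
  assumes "open \<Omega>" and "p \<in> \<Omega>" and "\<And>q. q \<in> \<Omega> \<Longrightarrow> u q = v q"
  shows "has_partial i u p D \<longleftrightarrow> has_partial i v p D"
  unfolding has_partial_def
  by (rule DERIV_cong_ev)
    (use eventually_line_in_open[OF assms(1,2), of i] in \<open>auto elim: eventually_mono simp: assms(3)\<close>)

lemma partial_partial_eqI:
  assumes "open \<Omega>" and "\<And>q. q \<in> \<Omega> \<Longrightarrow> has_partial i u q (u' q)"
    and "p \<in> \<Omega>" and "has_partial i u' p D"
  shows "has_partial i (partial i u) p D" and "partial i (partial i u) p = D"
proof -
  show "has_partial i (partial i u) p D"
    using assms has_partial_cong[of \<Omega> p "partial i u" u'] has_partial_imp_partial by blast
  then show "partial i (partial i u) p = D"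
    by (rule has_partial_imp_partial)
qed

lemma twice_partial_onI:
  assumes "open \<Omega>"
    and "\<And>i q. q \<in> \<Omega> \<Longrightarrow> has_partial i u q (u' i q)"
    and "\<And>i q. q \<in> \<Omega> \<Longrightarrow> \<exists>D. has_partial i (u' i) q D"
  shows "twice_partial_on \<Omega> u"
  unfolding twice_partial_on_def
  using assms partial_partial_eqI(1) has_partial_imp_partial by metis

lemma differentiable_imp_has_partial:
  assumes "u differentiable at p"
  shows "has_partial i u p (partial i u p)"
proof -
  from assms obtain u' where u': "(u has_derivative u') (at p)"
    unfolding differentiable_def by blast
  have "((\<lambda>s. u (p + s *\<^sub>R axis i 1)) has_derivative (\<lambda>s. u' (s *\<^sub>R axis i 1))) (at 0)"
    by (rule has_derivative_compose[of "\<lambda>s. p + s *\<^sub>R axis i 1"])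
      (use u' in \<open>auto intro!: derivative_eq_intros\<close>)
  moreover have "u' (s *\<^sub>R axis i 1) = u' (axis i 1) * s" for s
    using linear_scale[OF has_derivative_linear[OF u']] by simp
  ultimately have "has_partial i u p (u' (axis i 1))"
    unfolding has_partial_def has_field_derivative_def by simp
  then show ?thesis
    using has_partial_imp_partial by metis
qed

lemma Ck_on_2_imp_twice_partial_on:
  assumes "open \<Omega>" and "Ck_on 2 \<Omega> u"
  shows "twice_partial_on \<Omega> u"
  using assms
  by (auto simp: numeral_2_eq_2 twice_partial_on_def differentiable_on_eq_differentiable_at
      intro!: differentiable_imp_has_partial)

lemma twice_partial_on_diff:
  assumes "open \<Omega>" and u: "twice_partial_on \<Omega> u" and v: "twice_partial_on \<Omega> v"
  shows "twice_partial_on \<Omega> (\<lambda>q. u q - v q)"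
    and "p \<in> \<Omega> \<Longrightarrow> laplacian (\<lambda>q. u q - v q) p = laplacian u p - laplacian v p"
proof -
  have 1: "has_partial i (\<lambda>q. u q - v q) q (partial i u q - partial i v q)"
    and 2: "has_partial i (\<lambda>q. partial i u q - partial i v q) q
        (partial i (partial i u) q - partial i (partial i v) q)"
    if "q \<in> \<Omega>" for i q
    using u v that unfolding twice_partial_on_def has_partial_def
    by (auto intro!: DERIV_diff)
  show "twice_partial_on \<Omega> (\<lambda>q. u q - v q)"
    using twice_partial_onI[OF \<open>open \<Omega>\<close> 1] 2 by blast
  show "laplacian (\<lambda>q. u q - v q) p = laplacian u p - laplacian v p" if "p \<in> \<Omega>"
    unfolding laplacian_def
    by (simp add: partial_partial_eqI(2)[OF \<open>open \<Omega>\<close> 1 that 2[OF that]] sum_subtractf)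
qed

lemma laplacian_square:
  assumes "open \<Omega>" and r: "twice_partial_on \<Omega> r"
  shows "twice_partial_on \<Omega> (\<lambda>q. (r q)\<^sup>2)"
    and "p \<in> \<Omega> \<Longrightarrow> laplacian (\<lambda>q. (r q)\<^sup>2) p = 2 * r p * laplacian r p + 2 * (norm (grad r p))\<^sup>2"
proof -
  have 1: "has_partial i (\<lambda>q. (r q)\<^sup>2) q (2 * r q * partial i r q)"
    and 2: "has_partial i (\<lambda>q. 2 * r q * partial i r q) q
        (2 * r q * partial i (partial i r) q + 2 * (partial i r q)\<^sup>2)"
    if "q \<in> \<Omega>" for i q
    using r that unfolding twice_partial_on_def has_partial_def
    by (auto intro!: derivative_eq_intros simp: power2_eq_square)
  show "twice_partial_on \<Omega> (\<lambda>q. (r q)\<^sup>2)"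
    using twice_partial_onI[OF \<open>open \<Omega>\<close> 1] 2 by blast
  have "(norm (grad r p))\<^sup>2 = (\<Sum>i\<in>UNIV. (partial i r p)\<^sup>2)"
    unfolding power2_norm_eq_inner by (simp add: inner_vec_def grad_def power2_eq_square)
  then show "laplacian (\<lambda>q. (r q)\<^sup>2) p = 2 * r p * laplacian r p + 2 * (norm (grad r p))\<^sup>2"
    if "p \<in> \<Omega>"
    unfolding laplacian_def
    by (simp add: partial_partial_eqI(2)[OF \<open>open \<Omega>\<close> 1 that 2[OF that]] sum.distrib sum_distrib_left)
qed

lemma twice_partial_on_modulus:
  assumes "open \<Omega>" and x: "twice_partial_on \<Omega> x" and y: "twice_partial_on \<Omega> y"
    and nz: "\<And>q. q \<in> \<Omega> \<Longrightarrow> Complex (x q) (y q) \<noteq> 0"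
  shows "twice_partial_on \<Omega> (\<lambda>q. cmod (Complex (x q) (y q)))"
proof -
  let ?r = "\<lambda>q. sqrt ((x q)\<^sup>2 + (y q)\<^sup>2)"
  have pos: "(x q)\<^sup>2 + (y q)\<^sup>2 > 0" if "q \<in> \<Omega>" for q
    using nz[OF that] by (simp add: Complex_eq_0 sum_power2_gt_zero_iff)
  have d: "has_partial i x q (partial i x q)" "has_partial i y q (partial i y q)"
    "has_partial i (partial i x) q (partial i (partial i x) q)"
    "has_partial i (partial i y) q (partial i (partial i y) q)" if "q \<in> \<Omega>" for i q
    using x y that unfolding twice_partial_on_def by auto
  have 1: "has_partial i ?r q ((x q * partial i x q + y q * partial i y q) / ?r q)"
    if "q \<in> \<Omega>" for i q
  proof -
    have "((\<lambda>s. ?r (q + s *\<^sub>R axis i 1)) has_real_derivative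
        inverse (?r q) / 2 * (2 * (x q * partial i x q) + 2 * (y q * partial i y q))) (at 0)"
      using d(1,2)[OF that, of i] pos[OF that] unfolding has_partial_def
      by (auto intro!: derivative_eq_intros)
    moreover have "inverse R / 2 * (2 * a + 2 * b) = (a + b) / R" for R a b :: real
      by (simp add: divide_simps)
    ultimately show ?thesis
      unfolding has_partial_def by metis
  qed
  have "\<exists>D. has_partial i (\<lambda>q. (x q * partial i x q + y q * partial i y q) / ?r q) q D"
    if "q \<in> \<Omega>" for i q
  proof -
    have "?r (q + 0 *\<^sub>R axis i 1) \<noteq> 0"
      using pos[OF that] by auto
    note dxy = d[OF that, of i, unfolded has_partial_def]
      and dr = 1[OF that, of i, unfolded has_partial_def]
    show ?thesis
      unfolding has_partial_def
      by (rule exI, rule DERIV_divide[OF DERIV_add[OF DERIV_mult[OF dxy(1,3)] DERIV_mult[OF dxy(2,4)]]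
            dr \<open>?r (q + 0 *\<^sub>R axis i 1) \<noteq> 0\<close>])
  qed
  then have "twice_partial_on \<Omega> ?r"
    using twice_partial_onI[OF \<open>open \<Omega>\<close> 1] by blast
  then show ?thesis
    by (simp add: cmod_def)
qed

lemma second_derivative_nonpos_at_local_max:
  fixes \<phi> :: "real \<Rightarrow> real"
  assumes \<phi>: "\<forall>\<^sub>F s in nhds 0. (\<phi> has_real_derivative \<phi>' s) (at s)"
    and \<phi>': "(\<phi>' has_real_derivative c) (at 0)"
    and max: "\<forall>\<^sub>F s in nhds 0. \<phi> s \<le> \<phi> 0"
  shows "c \<le> 0"
proof (rule ccontr)
  assume "\<not> c \<le> 0"
  obtain d where "d > 0" and d: "\<And>s. \<bar>s\<bar> < d \<Longrightarrow> (\<phi> has_real_derivative \<phi>' s) (at s) \<and> \<phi> s \<le> \<phi> 0"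
    using eventually_conj[OF \<phi> max] unfolding eventually_nhds_metric by (auto simp: dist_real_def)
  have "\<phi>' 0 = 0"
    by (rule DERIV_local_max[where f = \<phi> and x = 0 and d = d]) (use d \<open>d > 0\<close> in auto)
  obtain e where "e > 0" and e: "\<And>h. 0 < h \<Longrightarrow> h < e \<Longrightarrow> \<phi>' 0 < \<phi>' (0 + h)"
    using DERIV_pos_inc_right[OF \<phi>'] \<open>\<not> c \<le> 0\<close> by force
  define h where "h = min d e / 2"
  have h: "0 < h" "h < d" "h < e"
    using \<open>d > 0\<close> \<open>e > 0\<close> by (auto simp: h_def)
  obtain z where z: "0 < z" "z < h" "\<phi> h - \<phi> 0 = h * \<phi>' z"
    using MVT2[of 0 h \<phi> \<phi>'] d h by auto
  have "\<phi>' z > 0"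
    using e[of z] z h \<open>\<phi>' 0 = 0\<close> by simp
  then have "\<phi> h > \<phi> 0"
    using z(3) h(1) mult_pos_pos[of h "\<phi>' z"] by linarith
  then show False
    using d[of h] h by simp
qed

lemma laplacian_nonpos_at_max:
  assumes "open \<Omega>" and u: "twice_partial_on \<Omega> u" and "p \<in> \<Omega>"
    and max: "\<And>q. q \<in> \<Omega> \<Longrightarrow> u q \<le> u p"
  shows "laplacian u p \<le> 0"
  unfolding laplacian_def
proof (rule sum_nonpos)
  fix i
  note line = eventually_line_in_open[OF \<open>open \<Omega>\<close> \<open>p \<in> \<Omega>\<close>, of i]
  show "partial i (partial i u) p \<le> 0"
  proof (rule second_derivative_nonpos_at_local_max)
    show "\<forall>\<^sub>F s in nhds 0. ((\<lambda>s. u (p + s *\<^sub>R axis i 1)) has_real_derivative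
        partial i u (p + s *\<^sub>R axis i 1)) (at s)"
      using line
    proof eventually_elim
      case (elim s)
      then have "has_partial i u (p + s *\<^sub>R axis i 1) (partial i u (p + s *\<^sub>R axis i 1))"
        using u unfolding twice_partial_on_def by blast
      then have "((\<lambda>h. u (p + (s + h) *\<^sub>R axis i 1)) has_real_derivative
          partial i u (p + s *\<^sub>R axis i 1)) (at 0)"
        unfolding has_partial_def by (simp add: scaleR_add_left add.assoc)
      then show ?case
        using DERIV_shift[of "\<lambda>s. u (p + s *\<^sub>R axis i 1)" _ 0 s] by (simp add: add.commute[of s])
    qed
    show "((\<lambda>s. partial i u (p + s *\<^sub>R axis i 1)) has_real_derivative
        partial i (partial i u) p) (at 0)"
      using u \<open>p \<in> \<Omega>\<close> unfolding twice_partial_on_def has_partial_def by blast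
    show "\<forall>\<^sub>F s in nhds 0. u (p + s *\<^sub>R axis i 1) \<le> u (p + 0 *\<^sub>R axis i 1)"
      using line by eventually_elim (use max in simp)
  qed
qed

lemma laplacian_norm_square:
  fixes p :: "real^'n::finite"
  assumes "open \<Omega>"
  shows "twice_partial_on \<Omega> (\<lambda>q::real^'n. - (c * (norm q)\<^sup>2))"
    and "p \<in> \<Omega> \<Longrightarrow> laplacian (\<lambda>q. - (c * (norm q)\<^sup>2)) p = - (2 * c * CARD('n))"
proof -
  have 1: "has_partial i (\<lambda>q::real^'n. - (c * (norm q)\<^sup>2)) q (- (2 * c * q $ i))" for i q
    unfolding has_partial_def power2_norm_eq_inner
    by (auto intro!: derivative_eq_intros
        simp: inner_axis inner_axis' algebra_simps)
  have 2: "has_partial i (\<lambda>q::real^'n. - (2 * c * q $ i)) q (- (2 * c))" for i q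
    unfolding has_partial_def by (auto intro!: derivative_eq_intros)
  show "twice_partial_on \<Omega> (\<lambda>q::real^'n. - (c * (norm q)\<^sup>2))"
    using twice_partial_onI[OF \<open>open \<Omega>\<close> 1] 2 by blast
  show "laplacian (\<lambda>q. - (c * (norm q)\<^sup>2)) p = - (2 * c * CARD('n))" if "p \<in> \<Omega>"
    unfolding laplacian_def by (simp add: partial_partial_eqI(2)[OF \<open>open \<Omega>\<close> 1 that 2])
qed

lemma weak_maximum_principle:
  fixes \<Omega> :: "(real^'n::finite) set"
  assumes "open \<Omega>" and "bounded \<Omega>" and w: "twice_partial_on \<Omega> w"
    and cont: "continuous_on (closure \<Omega>) w"
    and sub: "\<And>p. p \<in> \<Omega> \<Longrightarrow> laplacian w p \<ge> 0"
    and bdry: "\<And>p. p \<in> frontier \<Omega> \<Longrightarrow> w p \<le> 0"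
    and "p \<in> \<Omega>"
  shows "w p \<le> 0"
proof (rule ccontr)
  assume "\<not> w p \<le> 0"
  obtain B where "B > 0" and B: "\<And>q. q \<in> closure \<Omega> \<Longrightarrow> norm q \<le> B"
    using \<open>bounded \<Omega>\<close> bounded_closure bounded_pos by metis
  define c where "c = w p / (2 * B\<^sup>2)"
  have "c > 0"
    using \<open>\<not> w p \<le> 0\<close> \<open>B > 0\<close> by (simp add: c_def)
  define v where "v = (\<lambda>q. w q - - (c * (norm q)\<^sup>2))"
  note v_facts = twice_partial_on_diff[OF \<open>open \<Omega>\<close> w laplacian_norm_square(1)[OF \<open>open \<Omega>\<close>, of c],
      folded v_def]
  have "compact (closure \<Omega>)" "closure \<Omega> \<noteq> {}"
    using \<open>bounded \<Omega>\<close> \<open>p \<in> \<Omega>\<close> by auto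
  moreover have "continuous_on (closure \<Omega>) v"
    unfolding v_def by (intro continuous_intros cont)
  ultimately obtain m where "m \<in> closure \<Omega>" and m: "\<And>q. q \<in> closure \<Omega> \<Longrightarrow> v q \<le> v m"
    using continuous_attains_sup by metis
  show False
  proof (cases "m \<in> \<Omega>")
    case True
    have "laplacian v m \<le> 0"
      using laplacian_nonpos_at_max[OF \<open>open \<Omega>\<close> v_facts(1) True] m closure_subset by blast
    moreover have "laplacian v m = laplacian w m + 2 * c * CARD('n)"
      using v_facts(2)[OF True] laplacian_norm_square(2)[OF \<open>open \<Omega>\<close> True] by simp
    moreover have "2 * c * CARD('n) > 0"
      using \<open>c > 0\<close> by simp
    ultimately show False
      using sub[OF True] by linarith
  next
    case False
    then have "w m \<le> 0"
      using \<open>m \<in> closure \<Omega>\<close> \<open>open \<Omega>\<close> by (intro bdry) (simp add: frontier_def interior_open)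
    moreover have "c * (norm m)\<^sup>2 \<le> c * B\<^sup>2"
      using B[OF \<open>m \<in> closure \<Omega>\<close>] \<open>c > 0\<close> by (simp add: power_mono)
    moreover have "c * B\<^sup>2 = w p / 2"
      using \<open>B > 0\<close> by (simp add: c_def)
    moreover have "w p \<le> v p"
      using \<open>c > 0\<close> by (simp add: v_def)
    moreover have "v p \<le> v m"
      using m \<open>p \<in> \<Omega>\<close> closure_subset by blast
    ultimately show False
      using \<open>\<not> w p \<le> 0\<close> unfolding v_def by linarith
  qed
qed

lemma twice_partial_on_cmod_zpart:
  assumes "open \<Omega>" and "harmonic_curve \<Omega> f" and "\<forall>p\<in>\<Omega>. zpart f p \<noteq> 0"
  shows "twice_partial_on \<Omega> (\<lambda>q. cmod (zpart f q))"
  using assms unfolding zpart_def harmonic_curve_def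
  by (intro twice_partial_on_modulus Ck_on_2_imp_twice_partial_on) auto

lemma continuous_on_cmod_zpart:
  assumes "continuous_on S f"
  shows "continuous_on S (\<lambda>q. cmod (zpart f q))"
  unfolding zpart_def xpart_def ypart_def Complex_eq by (intro continuous_intros assms)

theorem corollary4p5:
  fixes \<Omega> :: "(real^'n::finite) set" and f g :: "real^'n \<Rightarrow> real^3"
  assumes "open \<Omega>" and "connected \<Omega>" and "\<Omega> \<noteq> {}" and "bounded \<Omega>"
    and "harmonic_curve \<Omega> f" and "x_function_of_y_on \<Omega> f"
    and "harmonic_curve \<Omega> g" and "x_function_of_y_on \<Omega> g"
    and "continuous_on (closure \<Omega>) f" and "continuous_on (closure \<Omega>) g"
    and "\<forall>p\<in>\<Omega>. zpart f p \<noteq> 0" and "\<forall>p\<in>\<Omega>. zpart g p \<noteq> 0"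
    and "\<forall>p\<in>\<Omega>. laplacian (\<lambda>q. cmod (zpart f q)) p
           + (norm (grad (\<lambda>q. cmod (zpart f q)) p))\<^sup>2 / cmod (zpart f p) \<ge> 0"
    and "\<forall>p\<in>\<Omega>. laplacian (\<lambda>q. cmod (zpart g q)) p
           + (norm (grad (\<lambda>q. cmod (zpart g q)) p))\<^sup>2 / cmod (zpart g p) \<le> 0"
    and "\<forall>p\<in>frontier \<Omega>. cmod (zpart f p) \<le> cmod (zpart g p)"
  shows "\<forall>p\<in>\<Omega>. cmod (zpart f p) \<le> cmod (zpart g p)"
proof -
  let ?r = "\<lambda>q. cmod (zpart f q)" and ?s = "\<lambda>q. cmod (zpart g q)"
  let ?w = "\<lambda>q. (?r q)\<^sup>2 - (?s q)\<^sup>2"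
  note r = laplacian_square[OF assms(1) twice_partial_on_cmod_zpart[OF assms(1,5,11)]]
  note s = laplacian_square[OF assms(1) twice_partial_on_cmod_zpart[OF assms(1,7,12)]]
  note w = twice_partial_on_diff[OF assms(1) r(1) s(1)]
  have sub: "laplacian ?w p \<ge> 0" if "p \<in> \<Omega>" for p
  proof -
    have pos: "?r p > 0" "?s p > 0"
      using assms(11,12) that by auto
    have "laplacian (\<lambda>q. (?r q)\<^sup>2) p = 2 * ?r p * (laplacian ?r p + (norm (grad ?r p))\<^sup>2 / ?r p)"
      using r(2)[OF that] pos by (simp add: field_simps)
    moreover have "\<dots> \<ge> 0"
      using assms(13) that pos by (intro mult_nonneg_nonneg) auto
    moreover have "laplacian (\<lambda>q. (?s q)\<^sup>2) p = 2 * ?s p * (laplacian ?s p + (norm (grad ?s p))\<^sup>2 / ?s p)"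
      using s(2)[OF that] pos by (simp add: field_simps)
    moreover have "\<dots> \<le> 0"
      using assms(14) that pos by (intro mult_nonneg_nonpos) auto
    ultimately show ?thesis
      using w(2)[OF that] by linarith
  qed
  have cont: "continuous_on (closure \<Omega>) ?w"
    by (intro continuous_intros continuous_on_cmod_zpart assms(9,10))
  have bdry: "?w p \<le> 0" if "p \<in> frontier \<Omega>" for p
    using assms(15) that by (simp add: power_mono)
  have "?w p \<le> 0" if "p \<in> \<Omega>" for p
    by (rule weak_maximum_principle[OF assms(1,4) w(1) cont sub bdry that])
  then show ?thesis
    by (auto intro: power2_le_imp_le)
qed

end
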